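(* Let $p:E\to B$ and $p':E'\to B$ be fibrations over $B$, let $\tau:E\to E$ be a fixed-point free involution with $p\circ\tau=p$, and let $F'$ be the fiber of $p'$ over a base point $b_0\in B$. Suppose that $E$ and $E'$ are Hausdorff spaces. If the triple $\left((p,\tau);p'\right)$ does not satisfy the parametrized Borsuk-Ulam property (PBUP), or the triple $\left((E,\tau);F'\right)$ does not satisfy the Borsuk-Ulam property (BUP), then \[\mathrm{secat}(q_E)\leq \mathrm{secat}(q^{p'}),\] where $q_E:E\to E/\tau$ and $q^{p'}:F_{p'}(E',2)\to F_{p'}(E',2)/\mathbb{Z}_2$ are the quotient maps. Equivalently, if $\mathrm{secat}(q_E)>\mathrm{secat}(q^{p'})$, then the triple $\left((p,\tau);p'\right)$ satisfies the PBUP and the triple $\left((E,\tau);F'\right)$ satisfies the BUP.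
   Context: "Space" means topological space, "map" means continuous map, and fibrations are Hurewicz fibrations. PBUP: the triple $((p,\tau);p')$, where $p:E\to B$, $p':E'\to B$ are fibrations and $\tau:E\to E$ is a fixed-point free involution with $p\circ\tau=p$, satisfies the parametrized Borsuk-Ulam property if for every map $f:E\to E'$ with $p'\circ f=p$ there exists $x\in E$ such that $f(\tau(x))=f(x)$. BUP: for Hausdorff spaces $X,Y$ and a fixed-point free involution $\tau:X\to X$, the triple $((X,\tau);Y)$ satisfies the Borsuk-Ulam property if for every map $f:X\to Y$ there exists $x\in X$ such that $f(\tau(x))=f(x)$. Fibre-wise configuration space: $F_{p'}(E',2)=\{(y_1,y_2)\in E'\times E': y_1\neq y_2,\ p'(y_1)=p'(y_2)\}$ with the subspace topology from $E'\times E'$; $\mathbb{Z}_2$ acts freely on it by $(y_1,y_2)\mapsto(y_2,y_1)$. Sectional category: for a fibration $p:E\to B$, $\mathrm{secat}(p)$ is the minimal cardinality of an open cover of $B$ such that over each element $U$ of the cover there is a map $s:U\to E$ with $p\circ s$ equal to the inclusion $U\hookrightarrow B$; $\mathrm{secat}(p)=\infty$ if no such finite cover exists. (For a Hausdorff space $X$ with fixed-point free involution $\tau$, the quotient map $X\to X/\tau$ is a 2-sheeted covering and a fibration.) *)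

theory Defs
  imports "HOL-Analysis.Analysis" "HOL-Library.Extended_Nat"
begin

definition has_homotopy_lifting ::
    "'x topology \<Rightarrow> 'e topology \<Rightarrow> 'b topology \<Rightarrow> ('e \<Rightarrow> 'b) \<Rightarrow> bool" where
  "has_homotopy_lifting X E B p \<longleftrightarrow>
     (\<forall>h f. continuous_map (prod_topology X (top_of_set {0..1::real})) B h \<and>
            continuous_map X E f \<and> (\<forall>x\<in>topspace X. p (f x) = h (x, 0)) \<longrightarrow>
        (\<exists>H. continuous_map (prod_topology X (top_of_set {0..1::real})) E H \<and>
             (\<forall>x\<in>topspace X. H (x, 0) = f x) \<and>
             (\<forall>x\<in>topspace X. \<forall>t\<in>{0..1}. p (H (x, t)) = h (x, t))))"

text \<open>
  A Hurewicz fibration has the homotopy lifting property for all spaces. A definition in HOL cannot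
  quantify over the carrier type of the test space \<open>X\<close>. The type chosen here is large enough to
  contain the space of pairs (point of \<open>E\<close>, path in \<open>B\<close> starting at its image); the lemma
  \<open>hurewicz_fibration_lifting\<close> below shows that lifting then holds for test spaces over every type.
\<close>

definition hurewicz_fibration :: "'e topology \<Rightarrow> 'b topology \<Rightarrow> ('e \<Rightarrow> 'b) \<Rightarrow> bool" where
  "hurewicz_fibration E B p \<longleftrightarrow>
     continuous_map E B p \<and>
     (\<forall>X :: ('e \<times> (real \<Rightarrow> 'b)) topology. has_homotopy_lifting X E B p)"

definition quotient_topology :: "'a topology \<Rightarrow> ('a \<Rightarrow> 'b) \<Rightarrow> 'b topology" where
  "quotient_topology X q =
     topology (\<lambda>U. U \<subseteq> q ` topspace X \<and> openin X {x \<in> topspace X. q x \<in> U})"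

lemma openin_quotient_topology:
  "openin (quotient_topology X q) U \<longleftrightarrow>
     U \<subseteq> q ` topspace X \<and> openin X {x \<in> topspace X. q x \<in> U}"
proof -
  let ?L = "\<lambda>U. U \<subseteq> q ` topspace X \<and> openin X {x \<in> topspace X. q x \<in> U}"
  have "istopology ?L"
    unfolding istopology_def
  proof (intro conjI allI impI)
    fix S T assume S: "?L S" and T: "?L T"
    then show "S \<inter> T \<subseteq> q ` topspace X" by blast
    have "{x \<in> topspace X. q x \<in> S \<inter> T} =
          {x \<in> topspace X. q x \<in> S} \<inter> {x \<in> topspace X. q x \<in> T}" by blast
    then show "openin X {x \<in> topspace X. q x \<in> S \<inter> T}"
      using S T by (simp add: openin_Int)
  next
    fix \<K> assume K: "\<forall>K\<in>\<K>. ?L K"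
    then show "\<Union>\<K> \<subseteq> q ` topspace X" by blast
    have "{x \<in> topspace X. q x \<in> \<Union>\<K>} = \<Union>((\<lambda>K. {x \<in> topspace X. q x \<in> K}) ` \<K>)" by blast
    then show "openin X {x \<in> topspace X. q x \<in> \<Union>\<K>}"
      using K by auto
  qed
  then show ?thesis
    by (simp add: quotient_topology_def topology_inverse')
qed

lemma topspace_quotient_topology [simp]:
  "topspace (quotient_topology X q) = q ` topspace X"
proof -
  have "{x \<in> topspace X. q x \<in> q ` topspace X} = topspace X" by blast
  then have "openin (quotient_topology X q) (q ` topspace X)"
    by (simp add: openin_quotient_topology)
  then show ?thesis
    by (meson openin_quotient_topology openin_subset openin_topspace subset_antisym)
qed

lemma quotient_map_quotient_topology: "quotient_map X (quotient_topology X q) q"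
  by (auto simp: quotient_map_def openin_quotient_topology)

lemma hurewicz_fibration_lifting:
  fixes X :: "'x topology" and E :: "'e topology" and B :: "'b topology"
  assumes fib: "hurewicz_fibration E B p"
  shows "has_homotopy_lifting X E B p"
  unfolding has_homotopy_lifting_def
proof (intro allI impI, elim conjE)
  fix h f
  let ?I = "top_of_set {0..1::real}"
  assume h: "continuous_map (prod_topology X ?I) B h" and f: "continuous_map X E f"
    and hf: "\<forall>x\<in>topspace X. p (f x) = h (x, 0)"
  define \<Phi> where "\<Phi> = (\<lambda>x. (f x, \<lambda>t. if t \<in> {0..1::real} then h (x, t) else undefined))"
  define Y where "Y = quotient_topology X \<Phi>"
  have q: "quotient_map X Y \<Phi>"
    unfolding Y_def by (rule quotient_map_quotient_topology)
  have loc: "locally_compact_space ?I"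
    by (intro compact_imp_locally_compact_space) (simp add: compact_space_subtopology)
  have qI: "quotient_map (prod_topology X ?I) (prod_topology Y ?I) (\<lambda>(x, t). (\<Phi> x, t))"
    by (rule quotient_map_prod_left [OF loc _ q]) (simp add: Hausdorff_space_subtopology)
  have f': "continuous_map Y E fst"
    by (rule continuous_compose_quotient_map [OF q])
       (use f in \<open>simp add: \<Phi>_def comp_def\<close>)
  define k where "k = (\<lambda>(y :: 'e \<times> (real \<Rightarrow> 'b), t). snd y t)"
  have "continuous_map (prod_topology X ?I) B (k \<circ> (\<lambda>(x, t). (\<Phi> x, t)))"
    by (rule continuous_map_eq [OF h]) (auto simp: k_def \<Phi>_def)
  then have k: "continuous_map (prod_topology Y ?I) B k"
    by (rule continuous_compose_quotient_map [OF qI])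
  have "\<forall>y\<in>topspace Y. p (fst y) = k (y, 0)"
    using hf by (auto simp: Y_def \<Phi>_def k_def)
  moreover have "has_homotopy_lifting Y E B p"
    using fib by (simp add: hurewicz_fibration_def)
  ultimately obtain H where H: "continuous_map (prod_topology Y ?I) E H"
      and H0: "\<forall>y\<in>topspace Y. H (y, 0) = fst y"
      and Hp: "\<forall>y\<in>topspace Y. \<forall>t\<in>{0..1}. p (H (y, t)) = k (y, t)"
    using f' k unfolding has_homotopy_lifting_def by blast
  let ?G = "H \<circ> (\<lambda>(x, t). (\<Phi> x, t))"
  have "continuous_map (prod_topology X ?I) E ?G"
    using continuous_map_compose [OF quotient_imp_continuous_map [OF qI] H] .
  moreover have "\<forall>x\<in>topspace X. ?G (x, 0) = f x"
    using H0 by (auto simp: Y_def \<Phi>_def)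
  moreover have "\<forall>x\<in>topspace X. \<forall>t\<in>{0..1}. p (?G (x, t)) = h (x, t)"
    using Hp by (auto simp: Y_def \<Phi>_def k_def)
  ultimately show "\<exists>H. continuous_map (prod_topology X ?I) E H \<and>
             (\<forall>x\<in>topspace X. H (x, 0) = f x) \<and>
             (\<forall>x\<in>topspace X. \<forall>t\<in>{0..1}. p (H (x, t)) = h (x, t))"
    by blast
qed

definition free_involution :: "'a topology \<Rightarrow> ('a \<Rightarrow> 'a) \<Rightarrow> bool" where
  "free_involution X \<tau> \<longleftrightarrow>
     continuous_map X X \<tau> \<and> (\<forall>x\<in>topspace X. \<tau> (\<tau> x) = x) \<and> (\<forall>x\<in>topspace X. \<tau> x \<noteq> x)"

definition orbit_map :: "('a \<Rightarrow> 'a) \<Rightarrow> 'a \<Rightarrow> 'a set" where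
  "orbit_map \<tau> x = {x, \<tau> x}"

definition orbit_space :: "'a topology \<Rightarrow> ('a \<Rightarrow> 'a) \<Rightarrow> 'a set topology" where
  "orbit_space X \<tau> = quotient_topology X (orbit_map \<tau>)"

definition PBUP :: "'e topology \<Rightarrow> ('e \<Rightarrow> 'b) \<Rightarrow> ('e \<Rightarrow> 'e) \<Rightarrow>
    'f topology \<Rightarrow> ('f \<Rightarrow> 'b) \<Rightarrow> bool" where
  "PBUP E p \<tau> E' p' \<longleftrightarrow>
     (\<forall>f. continuous_map E E' f \<and> (\<forall>x\<in>topspace E. p' (f x) = p x) \<longrightarrow>
        (\<exists>x\<in>topspace E. f (\<tau> x) = f x))"

definition BUP :: "'a topology \<Rightarrow> ('a \<Rightarrow> 'a) \<Rightarrow> 'c topology \<Rightarrow> bool" where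
  "BUP X \<tau> Y \<longleftrightarrow> (\<forall>f. continuous_map X Y f \<longrightarrow> (\<exists>x\<in>topspace X. f (\<tau> x) = f x))"

definition fibre_space :: "'f topology \<Rightarrow> ('f \<Rightarrow> 'b) \<Rightarrow> 'b \<Rightarrow> 'f topology" where
  "fibre_space E p b = subtopology E {y \<in> topspace E. p y = b}"

definition fibrewise_conf2 :: "'f topology \<Rightarrow> ('f \<Rightarrow> 'b) \<Rightarrow> ('f \<times> 'f) topology" where
  "fibrewise_conf2 E p =
     subtopology (prod_topology E E) {(y1, y2). y1 \<noteq> y2 \<and> p y1 = p y2}"

text \<open>The infimum of the empty set in \<^typ>\<open>enat\<close> is \<open>\<infinity>\<close>, the value when no finite cover exists.\<close>

definition secat :: "'e topology \<Rightarrow> 'b topology \<Rightarrow> ('e \<Rightarrow> 'b) \<Rightarrow> enat" where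
  "secat E B p = Inf {enat (card \<U>) | \<U>.
     finite \<U> \<and> (\<forall>U\<in>\<U>. openin B U) \<and> \<Union>\<U> = topspace B \<and>
     (\<forall>U\<in>\<U>. \<exists>s. continuous_map (subtopology B U) E s \<and> (\<forall>b\<in>U. p (s b) = b))}"

end

theory Submission
  imports Defs
begin

text \<open>
  A map \<open>f\<close> violating either Borsuk-Ulam property yields the \<open>\<int>\<^sub>2\<close>-equivariant map \<open>x \<mapsto> (f x, f (\<tau> x))\<close>
  into the fibrewise configuration space. Sectional category of the orbit map is monotone under
  equivariant maps \<open>\<phi>\<close> into Hausdorff spaces: over the preimage of an open set with section \<open>s\<close>, each
  orbit has exactly one point \<open>x\<close> at which \<open>\<phi> x\<close> is the value of \<open>s\<close>, and the set of these \<open>x\<close> is open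
  because its complement is the coincidence set of two maps into a Hausdorff space.
\<close>

lemma orbit_map_involution:
  assumes "free_involution X \<tau>" "x \<in> topspace X"
  shows "orbit_map \<tau> (\<tau> x) = orbit_map \<tau> x"
  using assms by (auto simp: free_involution_def orbit_map_def)

lemma continuous_map_orbit_map: "continuous_map X (orbit_space X \<tau>) (orbit_map \<tau>)"
  unfolding orbit_space_def
  by (rule quotient_imp_continuous_map [OF quotient_map_quotient_topology])

text \<open>The saturation of an open set is its union with its preimage under the continuous map
  \<open>\<tau>\<close>, hence open.\<close>

lemma open_map_orbit_map:
  assumes inv: "free_involution X \<tau>"
  shows "open_map X (orbit_space X \<tau>) (orbit_map \<tau>)"
  unfolding open_map_def
proof (intro allI impI)
  fix S assume S: "openin X S"
  have SX: "S \<subseteq> topspace X"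
    using S by (rule openin_subset)
  have "{x \<in> topspace X. orbit_map \<tau> x \<in> orbit_map \<tau> ` S} = S \<union> {x \<in> topspace X. \<tau> x \<in> S}"
  proof (intro equalityI subsetI)
    fix x assume "x \<in> {x \<in> topspace X. orbit_map \<tau> x \<in> orbit_map \<tau> ` S}"
    then show "x \<in> S \<union> {x \<in> topspace X. \<tau> x \<in> S}"
      by (auto simp: orbit_map_def doubleton_eq_iff)
  next
    fix x assume "x \<in> S \<union> {x \<in> topspace X. \<tau> x \<in> S}"
    then show "x \<in> {x \<in> topspace X. orbit_map \<tau> x \<in> orbit_map \<tau> ` S}"
      using SX orbit_map_involution [OF inv] by (auto simp: image_iff)
  qed
  moreover have "openin X {x \<in> topspace X. \<tau> x \<in> S}"
    using inv S by (auto simp: free_involution_def intro: openin_continuous_map_preimage)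
  ultimately show "openin (orbit_space X \<tau>) (orbit_map \<tau> ` S)"
    unfolding orbit_space_def openin_quotient_topology
    using S SX by (auto simp: image_mono)
qed

text \<open>The open set \<open>W\<close> built in the proof meets each orbit in \<open>A\<close>
  exactly once. The open map \<open>orbit_map \<tau>\<close> therefore restricts to a homeomorphism
  from \<open>W\<close> onto the image of \<open>A\<close>, and its inverse is the desired
  section.\<close>

lemma pullback_orbit_section:
  assumes X: "free_involution X \<tau>" and Y: "free_involution Y \<sigma>" and "Hausdorff_space Y"
    and \<phi>: "continuous_map X Y \<phi>" and eq: "\<And>x. x \<in> topspace X \<Longrightarrow> \<phi> (\<tau> x) = \<sigma> (\<phi> x)"
    and U: "openin (orbit_space Y \<sigma>) U"
    and s: "continuous_map (subtopology (orbit_space Y \<sigma>) U) Y s"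
    and sec: "\<forall>b\<in>U. orbit_map \<sigma> (s b) = b"
  defines "A \<equiv> {x \<in> topspace X. orbit_map \<sigma> (\<phi> x) \<in> U}"
  shows "openin X A"
    and "\<exists>t. continuous_map (subtopology (orbit_space X \<tau>) (orbit_map \<tau> ` A)) X t \<and>
             (\<forall>b\<in>orbit_map \<tau> ` A. orbit_map \<tau> (t b) = b)"
proof -
  have \<tau>: "continuous_map X X \<tau>"
    and \<tau>X: "\<And>x. x \<in> topspace X \<Longrightarrow> \<tau> x \<in> topspace X"
    using X by (auto simp: free_involution_def continuous_map_def)
  have \<phi>Y: "\<And>x. x \<in> topspace X \<Longrightarrow> \<phi> x \<in> topspace Y"
    using \<phi> by (auto simp: continuous_map_def)
  have c: "continuous_map X (orbit_space Y \<sigma>) (orbit_map \<sigma> \<circ> \<phi>)"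
    using \<phi> continuous_map_orbit_map by (rule continuous_map_compose)
  show oA: "openin X A"
    using openin_continuous_map_preimage [OF c U] by (simp add: A_def)
  \<comment> \<open>\<open>\<psi> x\<close> is the representative that \<open>s\<close> selects from
    the orbit of \<open>\<phi> x\<close>.\<close>
  define \<psi> where "\<psi> = s \<circ> (orbit_map \<sigma> \<circ> \<phi>)"
  have "continuous_map (subtopology X A) (subtopology (orbit_space Y \<sigma>) U) (orbit_map \<sigma> \<circ> \<phi>)"
    using c by (auto simp: continuous_map_in_subtopology continuous_map_from_subtopology A_def)
  then have \<psi>: "continuous_map (subtopology X A) Y \<psi>"
    unfolding \<psi>_def using s by (rule continuous_map_compose)
  have "continuous_map (subtopology X A) Y (\<phi> \<circ> \<tau>)"
    using \<tau> \<phi> by (intro continuous_map_from_subtopology continuous_map_compose)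
  \<comment> \<open>The intended slice is where \<open>\<phi> x = \<psi> x\<close>, but a
    coincidence set is only known to be closed. Removing the points where
    \<open>\<phi> (\<tau> x) = \<psi> x\<close> gives an open set instead; \<open>W_iff\<close>
    shows that it is the same slice.\<close>
  define W where "W = A - {x \<in> topspace (subtopology X A). (\<phi> \<circ> \<tau>) x = \<psi> x}"
  have "closedin (subtopology X A) {x \<in> topspace (subtopology X A). (\<phi> \<circ> \<tau>) x = \<psi> x}"
    by (rule closedin_continuous_maps_eq) fact+
  then have "openin (subtopology X A) W"
    using oA unfolding W_def by (intro openin_diff) (simp_all add: openin_open_subtopology)
  then have oW: "openin X W"
    using oA by (rule openin_trans_full)
  have WX: "W \<subseteq> topspace X" and WA: "W \<subseteq> A"
    by (auto simp: W_def A_def)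
  have \<psi>_cases: "\<psi> x = \<phi> x \<or> \<psi> x = \<sigma> (\<phi> x)" if "x \<in> A" for x
  proof -
    have "orbit_map \<sigma> (\<psi> x) = orbit_map \<sigma> (\<phi> x)"
      using sec that by (simp add: \<psi>_def A_def)
    then show ?thesis by (auto simp: orbit_map_def doubleton_eq_iff)
  qed
  \<comment> \<open>Equivariance puts \<open>\<phi> (\<tau> x)\<close> in the orbit of
    \<open>\<phi> x\<close>, and both \<open>A\<close> and \<open>\<psi>\<close> depend only on that
    orbit.\<close>
  have \<tau>A: "\<tau> x \<in> A" and \<psi>\<tau>: "\<psi> (\<tau> x) = \<psi> x" if "x \<in> A" for x
    using that eq \<tau>X \<phi>Y orbit_map_involution [OF Y] by (auto simp: A_def \<psi>_def)
  \<comment> \<open>The value \<open>\<psi> x\<close> is one of \<open>\<phi> x\<close> and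
    \<open>\<sigma> (\<phi> x) = \<phi> (\<tau> x)\<close>; freeness of \<open>\<sigma>\<close>
    makes these alternatives exclusive.\<close>
  have W_iff: "x \<in> W \<longleftrightarrow> \<phi> x = \<psi> x" if "x \<in> A" for x
  proof -
    have "x \<in> topspace X"
      using that by (simp add: A_def)
    then have "\<phi> (\<tau> x) = \<sigma> (\<phi> x)" "\<sigma> (\<phi> x) \<noteq> \<phi> x"
      using eq Y \<phi>Y by (simp_all add: free_involution_def)
    moreover have "x \<in> W \<longleftrightarrow> \<phi> (\<tau> x) \<noteq> \<psi> x"
      using that \<open>x \<in> topspace X\<close> by (simp add: W_def)
    ultimately show ?thesis
      using \<psi>_cases [OF that] by metis
  qed
  \<comment> \<open>Distinct points of one orbit are \<open>x\<close> and \<open>\<tau> x\<close>.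
    If \<open>\<tau> x\<close> lies in \<open>W\<close>, then
    \<open>\<phi> (\<tau> x) = \<psi> (\<tau> x) = \<psi> x\<close>, which is the condition
    excluding \<open>x\<close>.\<close>
  have W_unique: "x = y" if "x \<in> W" "y \<in> W" "orbit_map \<tau> x = orbit_map \<tau> y" for x y
  proof (rule ccontr)
    assume "x \<noteq> y"
    with that have y: "y = \<tau> x" by (auto simp: orbit_map_def doubleton_eq_iff)
    have "x \<in> A" using that WA by blast
    then have "\<phi> (\<tau> x) = \<psi> x" using W_iff [OF \<tau>A] \<psi>\<tau> that y by simp
    with that(1) show False using WX by (auto simp: W_def)
  qed
  have W_meets: "\<exists>y\<in>W. orbit_map \<tau> y = orbit_map \<tau> x" if "x \<in> A" for x
  proof (cases "x \<in> W")
    case False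
    then have "\<phi> (\<tau> x) = \<psi> (\<tau> x)" using that \<psi>\<tau> by (auto simp: W_def A_def)
    then have "\<tau> x \<in> W" using W_iff [OF \<tau>A] that by simp
    then show ?thesis using orbit_map_involution [OF X] that by (auto simp: A_def)
  qed blast
  define t where "t = inv_into W (orbit_map \<tau>)"
  have inj: "inj_on (orbit_map \<tau>) W"
    using W_unique by (auto simp: inj_on_def)
  \<comment> \<open>The map \<open>t\<close> inverts \<open>orbit_map \<tau>\<close> on the image of
    \<open>W\<close>, while the goal concerns the image of \<open>A\<close>.\<close>
  have img: "orbit_map \<tau> ` A = orbit_map \<tau> ` W"
  proof
    show "orbit_map \<tau> ` A \<subseteq> orbit_map \<tau> ` W"
      using W_meets by (metis image_eqI image_subsetI)
  qed (use WA in blast)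
  have "continuous_map (subtopology (orbit_space X \<tau>) (orbit_map \<tau> ` W)) X t"
    unfolding continuous_map
  proof (intro conjI allI impI)
    show "t ` topspace (subtopology (orbit_space X \<tau>) (orbit_map \<tau> ` W)) \<subseteq> topspace X"
      using WX by (auto simp: t_def inv_into_f_f [OF inj])
  next
    fix S assume "openin X S"
    then have "openin (orbit_space X \<tau>) (orbit_map \<tau> ` (W \<inter> S))"
      using open_map_orbit_map [OF X] oW by (auto simp: open_map_def)
    moreover have "{b \<in> topspace (subtopology (orbit_space X \<tau>) (orbit_map \<tau> ` W)). t b \<in> S}
        = orbit_map \<tau> ` (W \<inter> S)"
      using WX by (auto simp: orbit_space_def t_def inv_into_f_f [OF inj])
    ultimately show "openin (subtopology (orbit_space X \<tau>) (orbit_map \<tau> ` W))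
        {b \<in> topspace (subtopology (orbit_space X \<tau>) (orbit_map \<tau> ` W)). t b \<in> S}"
      unfolding openin_subtopology by (intro exI [of _ "orbit_map \<tau> ` (W \<inter> S)"]) auto
  qed
  then show "\<exists>t. continuous_map (subtopology (orbit_space X \<tau>) (orbit_map \<tau> ` A)) X t \<and>
             (\<forall>b\<in>orbit_map \<tau> ` A. orbit_map \<tau> (t b) = b)"
    unfolding img by (auto simp: t_def f_inv_into_f)
qed

text \<open>Every finite cover of the target orbit space by open sets with sections pulls back along
  \<open>\<phi>\<close> to such a cover of the source orbit space with no more members.\<close>

lemma secat_orbit_map_mono:
  assumes X: "free_involution X \<tau>" and Y: "free_involution Y \<sigma>" and "Hausdorff_space Y"
    and \<phi>: "continuous_map X Y \<phi>" and eq: "\<And>x. x \<in> topspace X \<Longrightarrow> \<phi> (\<tau> x) = \<sigma> (\<phi> x)"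
  shows "secat X (orbit_space X \<tau>) (orbit_map \<tau>) \<le> secat Y (orbit_space Y \<sigma>) (orbit_map \<sigma>)"
  unfolding secat_def [of Y]
\<comment> \<open>This also handles a target without any finite cover: the infimum of the empty set
  is infinite, and there is nothing to check.\<close>
proof (rule Inf_greatest, clarify)
  fix \<U> assume fin: "finite \<U>" and op: "\<forall>U\<in>\<U>. openin (orbit_space Y \<sigma>) U"
    and cov: "\<Union>\<U> = topspace (orbit_space Y \<sigma>)"
    and sec: "\<forall>U\<in>\<U>. \<exists>s. continuous_map (subtopology (orbit_space Y \<sigma>) U) Y s \<and>
                (\<forall>b\<in>U. orbit_map \<sigma> (s b) = b)"
  define A where "A = (\<lambda>U. {x \<in> topspace X. orbit_map \<sigma> (\<phi> x) \<in> U})"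
  define V where "V = (\<lambda>U. orbit_map \<tau> ` A U)"
  have A: "openin X (A U)"
    and V: "\<exists>t. continuous_map (subtopology (orbit_space X \<tau>) (V U)) X t \<and>
                 (\<forall>b\<in>V U. orbit_map \<tau> (t b) = b)" if U: "U \<in> \<U>" for U
  proof -
    obtain s where "continuous_map (subtopology (orbit_space Y \<sigma>) U) Y s"
      and "\<forall>b\<in>U. orbit_map \<sigma> (s b) = b"
      using sec U by blast
    note pullback = pullback_orbit_section
      [OF X Y \<open>Hausdorff_space Y\<close> \<phi> eq bspec [OF op U] this]
    show "openin X (A U)"
      unfolding A_def by (rule pullback(1))
    show "\<exists>t. continuous_map (subtopology (orbit_space X \<tau>) (V U)) X t \<and>
                 (\<forall>b\<in>V U. orbit_map \<tau> (t b) = b)"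
      unfolding V_def A_def by (rule pullback(2))
  qed
  have oV: "openin (orbit_space X \<tau>) (V U)" if "U \<in> \<U>" for U
    using open_map_orbit_map [OF X] A [OF that] by (auto simp: open_map_def V_def)
  have "topspace X \<subseteq> \<Union>(A ` \<U>)"
  proof
    fix x assume x: "x \<in> topspace X"
    then have "orbit_map \<sigma> (\<phi> x) \<in> \<Union>\<U>"
      using \<phi> unfolding cov by (auto simp: orbit_space_def continuous_map_def)
    with x show "x \<in> \<Union>(A ` \<U>)" by (auto simp: A_def)
  qed
  moreover have "A U \<subseteq> topspace X" for U
    by (auto simp: A_def)
  ultimately have "\<Union>(V ` \<U>) = topspace (orbit_space X \<tau>)"
    by (fastforce simp: V_def orbit_space_def)
  then have "secat X (orbit_space X \<tau>) (orbit_map \<tau>) \<le> enat (card (V ` \<U>))"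
    unfolding secat_def using fin oV V by (intro Inf_lower) blast
  \<comment> \<open>Different members of \<open>\<U>\<close> may have the same pullback, so only an
    inequality of cardinalities holds.\<close>
  also have "\<dots> \<le> enat (card \<U>)"
    using fin by (simp add: card_image_le)
  finally show "secat X (orbit_space X \<tau>) (orbit_map \<tau>) \<le> enat (card \<U>)" .
qed

lemma free_involution_swap: "free_involution (fibrewise_conf2 E p) prod.swap"
proof -
  have "continuous_map (prod_topology E E) (prod_topology E E) prod.swap"
    by (simp add: continuous_map_pairwise comp_def continuous_map_fst continuous_map_snd)
  then show ?thesis
    by (auto simp: free_involution_def fibrewise_conf2_def continuous_map_in_subtopology
        continuous_map_from_subtopology)
qed

text \<open>It suffices that \<open>f x\<close> and \<open>f (\<tau> x)\<close> share a fibre of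
  \<open>p'\<close>; \<open>f\<close> need not cover a given map to the base. This form serves
  fibrewise maps and maps into a single fibre alike.\<close>

lemma secat_le_conf2:
  assumes "free_involution E \<tau>" "Hausdorff_space E'" and f: "continuous_map E E' f"
    and p': "\<And>x. x \<in> topspace E \<Longrightarrow> p' (f (\<tau> x)) = p' (f x)"
    and ne: "\<And>x. x \<in> topspace E \<Longrightarrow> f (\<tau> x) \<noteq> f x"
  shows "secat E (orbit_space E \<tau>) (orbit_map \<tau>)
    \<le> secat (fibrewise_conf2 E' p')
        (orbit_space (fibrewise_conf2 E' p') prod.swap) (orbit_map prod.swap)"
proof (rule secat_orbit_map_mono)
  show "Hausdorff_space (fibrewise_conf2 E' p')"
    unfolding fibrewise_conf2_def
    using assms(2) by (simp add: Hausdorff_space_subtopology Hausdorff_space_prod_topology)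
  have "continuous_map E E' (f \<circ> \<tau>)"
    using assms(1) f by (auto simp: free_involution_def intro: continuous_map_compose)
  then have "continuous_map E (prod_topology E' E') (\<lambda>x. (f x, f (\<tau> x)))"
    using f by (simp add: continuous_map_pairwise comp_def)
  then show "continuous_map E (fibrewise_conf2 E' p') (\<lambda>x. (f x, f (\<tau> x)))"
    using p' ne unfolding fibrewise_conf2_def by (fastforce simp: continuous_map_in_subtopology)
  show "(f (\<tau> x), f (\<tau> (\<tau> x))) = prod.swap (f x, f (\<tau> x))" if "x \<in> topspace E" for x
    using assms(1) that by (simp add: free_involution_def)
qed (use assms free_involution_swap in auto)

theorem theorem3p10:
  fixes E :: "'e topology" and E' :: "'f topology" and B :: "'b topology"
    and p :: "'e \<Rightarrow> 'b" and p' :: "'f \<Rightarrow> 'b" and \<tau> :: "'e \<Rightarrow> 'e" and b0 :: 'b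
  assumes "hurewicz_fibration E B p"
    and "hurewicz_fibration E' B p'"
    and "free_involution E \<tau>"
    and "\<forall>x\<in>topspace E. p (\<tau> x) = p x"
    and "b0 \<in> topspace B"
    and "Hausdorff_space E"
    and "Hausdorff_space E'"
  shows "(\<not> PBUP E p \<tau> E' p' \<or> \<not> BUP E \<tau> (fibre_space E' p' b0) \<longrightarrow>
            secat E (orbit_space E \<tau>) (orbit_map \<tau>)
              \<le> secat (fibrewise_conf2 E' p')
                  (orbit_space (fibrewise_conf2 E' p') prod.swap) (orbit_map prod.swap)) \<and>
         (secat E (orbit_space E \<tau>) (orbit_map \<tau>)
              > secat (fibrewise_conf2 E' p')
                  (orbit_space (fibrewise_conf2 E' p') prod.swap) (orbit_map prod.swap) \<longrightarrow>
            PBUP E p \<tau> E' p' \<and> BUP E \<tau> (fibre_space E' p' b0))"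
proof -
  have \<tau>E: "\<tau> x \<in> topspace E" if "x \<in> topspace E" for x
    using assms(3) that by (auto simp: free_involution_def continuous_map_def)
  have *: "secat E (orbit_space E \<tau>) (orbit_map \<tau>)
              \<le> secat (fibrewise_conf2 E' p')
                  (orbit_space (fibrewise_conf2 E' p') prod.swap) (orbit_map prod.swap)"
    if "\<not> PBUP E p \<tau> E' p' \<or> \<not> BUP E \<tau> (fibre_space E' p' b0)"
    using that
  proof
    assume "\<not> PBUP E p \<tau> E' p'"
    then obtain f where f: "continuous_map E E' f" and "\<forall>x\<in>topspace E. p' (f x) = p x"
      and "\<forall>x\<in>topspace E. f (\<tau> x) \<noteq> f x"
      by (auto simp: PBUP_def)
    then show ?thesis
      \<comment> \<open>Here
        \<open>p' (f (\<tau> x)) = p (\<tau> x) = p x = p' (f x)\<close>.\<close>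
      using assms(4) \<tau>E by (intro secat_le_conf2 [OF assms(3,7) f]) auto
  next
    assume "\<not> BUP E \<tau> (fibre_space E' p' b0)"
    then obtain f where "continuous_map E (fibre_space E' p' b0) f"
      and "\<forall>x\<in>topspace E. f (\<tau> x) \<noteq> f x"
      by (auto simp: BUP_def)
    \<comment> \<open>Composed with the inclusion of the fibre, \<open>f\<close> becomes a map into
      \<open>E'\<close> for which \<open>p' \<circ> f\<close> is constant.\<close>
    moreover from this have f: "continuous_map E E' f" and "\<forall>x\<in>topspace E. p' (f x) = b0"
      by (auto simp: fibre_space_def continuous_map_in_subtopology)
    ultimately show ?thesis
      using \<tau>E by (intro secat_le_conf2 [OF assms(3,7) f]) auto
  qed
  \<comment> \<open>The second conjunct is the contrapositive of \<open>*\<close>.\<close>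
  then show ?thesis by (meson leD)
qed

end
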